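(* Let $k\in\mathbb{N}$ with $k\ge 1$, and let $p\ge 1$ be real or $p=\infty$. Let $d^p$ be the metric on $\mathbb{R}^k$ given by $$d^p(\mathbf{x},\mathbf{y})=\Big(\big(\sum_{i:\,x_i\ge y_i}(x_i-y_i)\big)^p+\big(\sum_{i:\,x_i<y_i}(y_i-x_i)\big)^p\Big)^{1/p}$$ (for $p=\infty$, the maximum of the two sums), and let $d_{\mathrm{M}}^p(\mathbf{x},\mathbf{y})=\big(\sum_{i=1}^k|x_i-y_i|^p\big)^{1/p}$ (for $p=\infty$, $\max_i|x_i-y_i|$) be the Minkowski distance with the same parameter $p$. Then $d^p$ and $d_{\mathrm{M}}^p$ are equivalent metrics, in the sense that there exist positive constants $\alpha$ and $\beta$ such that for all $\mathbf{x},\mathbf{y}\in\mathbb{R}^k$ $$\alpha\, d^p(\mathbf{x},\mathbf{y})\le d_{\mathrm{M}}^p(\mathbf{x},\mathbf{y})\le\beta\, d^p(\mathbf{x},\mathbf{y}).$$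
   Context: Here $\mathbf{x}=(x_1,\dots,x_k)$, $\mathbf{y}=(y_1,\dots,y_k)$; empty sums are $0$. *)

theory Defs
  imports "HOL-Analysis.Analysis"
begin

text \<open>The exponent ranges over the extended reals, so that one parameter covers both a real
  exponent and infinity. The definitions are only meant for exponents that are at least \<open>1\<close>;
  then the value of \<open>powr\<close> at base \<open>0\<close>, which is \<open>0\<close>, is the intended one.\<close>

definition up_sum :: "real ^ 'n \<Rightarrow> real ^ 'n \<Rightarrow> real" where
  "up_sum x y = (\<Sum>i\<in>{i. x $ i \<ge> y $ i}. x $ i - y $ i)"

definition down_sum :: "real ^ 'n \<Rightarrow> real ^ 'n \<Rightarrow> real" where
  "down_sum x y = (\<Sum>i\<in>{i. x $ i < y $ i}. y $ i - x $ i)"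

definition split_dist :: "ereal \<Rightarrow> real ^ 'n \<Rightarrow> real ^ 'n \<Rightarrow> real" where
  "split_dist p x y =
     (if p = \<infinity> then max (up_sum x y) (down_sum x y)
      else (up_sum x y powr real_of_ereal p + down_sum x y powr real_of_ereal p)
             powr (1 / real_of_ereal p))"

definition minkowski_dist :: "ereal \<Rightarrow> real ^ 'n \<Rightarrow> real ^ 'n \<Rightarrow> real" where
  "minkowski_dist p x y =
     (if p = \<infinity> then Max (range (\<lambda>i. \<bar>x $ i - y $ i\<bar>))
      else (\<Sum>i\<in>UNIV. \<bar>x $ i - y $ i\<bar> powr real_of_ereal p) powr (1 / real_of_ereal p))"

end

theory Submission
  imports Defs
begin

text \<open>Both distances are \<open>\<ell>\<^sup>p\<close> norms of nonnegative vectors: the Minkowski distance of the vector of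
  absolute differences, and \<open>d\<^sup>p\<close> of the pair formed by the up-sum and the down-sum. Minkowski's
  inequality and the monotonicity of the norm give the triangle inequalities. An \<open>\<ell>\<^sup>p\<close> norm lies
  between each of its entries and the sum of all of them, and both vectors have the same sum, the
  \<open>\<ell>\<^sup>1\<close> distance, to which both metrics are therefore equivalent.\<close>

definition lp_norm :: "ereal \<Rightarrow> 'a set \<Rightarrow> ('a \<Rightarrow> real) \<Rightarrow> real" where
  "lp_norm p I f =
     (if p = \<infinity> then Max (f ` I)
      else (\<Sum>i\<in>I. f i powr real_of_ereal p) powr (1 / real_of_ereal p))"

section \<open>Powers with a real exponent\<close>

lemma real_exponent_ge_1:
  assumes "1 \<le> p" "p \<noteq> \<infinity>"
  shows "1 \<le> real_of_ereal p"
  using assms by (cases p) (auto simp: one_ereal_def)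

lemma le_powr_inverse:
  fixes a b q :: real
  assumes "0 < q" "0 \<le> a" "a powr q \<le> b"
  shows "a \<le> b powr (1 / q)"
proof -
  have "a = (a powr q) powr (1 / q)"
    using assms by (simp add: powr_powr)
  also have "\<dots> \<le> b powr (1 / q)"
    using assms by (intro powr_mono2) auto
  finally show ?thesis .
qed

lemma powr_inverse_le:
  fixes a b q :: real
  assumes "0 < q" "0 \<le> a" "0 \<le> b" "b \<le> a powr q"
  shows "b powr (1 / q) \<le> a"
proof -
  have "b powr (1 / q) \<le> (a powr q) powr (1 / q)"
    using assms by (intro powr_mono2) auto
  also have "\<dots> = a"
    using assms by (simp add: powr_powr)
  finally show ?thesis .
qed

text \<open>The library's \<open>powr_convex\<close> excludes the base \<open>0\<close>.\<close>

lemma powr_convex_combination_le: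
  fixes a b q u v :: real
  assumes q: "1 \<le> q" and nonneg: "0 \<le> a" "0 \<le> b" "0 \<le> u" "0 \<le> v" and uv: "u + v = 1"
  shows "(u * a + v * b) powr q \<le> u * a powr q + v * b powr q"
proof -
  \<comment> \<open>If \<open>a\<close> or \<open>b\<close> is 0, one summand vanishes on each side,
    because \<open>0 powr q = 0\<close>. What remains is this inequality for a single weight
    \<open>t\<close>, and it follows from \<open>t powr q\<close> \<le> \<open>t\<close> on
    [0, 1].\<close>
  have scale: "(t * c) powr q \<le> t * c powr q" if "0 \<le> t" "t \<le> 1" "0 \<le> c" for t c :: real
  proof -
    have "t powr q \<le> t"
      using powr_mono'[of 1 q t] q that by simp
    then show ?thesis
      using that by (simp add: powr_mult mult_right_mono)
  qed
  consider "a = 0" | "b = 0" | "0 < a" "0 < b"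
    using nonneg by linarith
  then show ?thesis
  proof cases
    case 1
    then show ?thesis using scale[of v b] nonneg uv by simp
  next
    case 2
    then show ?thesis using scale[of u a] nonneg uv by simp
  next
    case 3
    have "u = 1 - v" using uv by simp
    then show ?thesis
      using convex_onD[OF powr_convex[OF q], of v a b] 3 nonneg by simp
  qed
qed

section \<open>Bounds, monotonicity and Minkowski's inequality for \<open>lp_norm\<close>\<close>

context
  fixes p :: ereal and I :: "'a set" and f :: "'a \<Rightarrow> real"
  assumes p: "1 \<le> p" and I: "finite I" "I \<noteq> {}" and f: "\<And>i. i \<in> I \<Longrightarrow> 0 \<le> f i"
begin

lemma member_le_lp_norm:
  assumes "i \<in> I"
  shows "f i \<le> lp_norm p I f"
proof (cases "p = \<infinity>")
  case True
  then show ?thesis using assms I by (simp add: lp_norm_def)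
next
  case False
  have "f i powr real_of_ereal p \<le> (\<Sum>i\<in>I. f i powr real_of_ereal p)"
    using assms I by (intro member_le_sum) auto
  then show ?thesis
    using False real_exponent_ge_1[OF p False] f[OF assms]
    by (simp add: lp_norm_def le_powr_inverse)
qed

lemma lp_norm_nonneg: "0 \<le> lp_norm p I f"
  using I f member_le_lp_norm by (meson all_not_in_conv order_trans)

text \<open>For a real exponent \<open>q\<close>, let \<open>S\<close> be the sum and bound all but
  one factor of each power by \<open>S\<close>. Adding the bounds
  \<open>f i * S powr (q - 1)\<close> gives \<open>S powr q\<close>, and a root is taken.\<close>

lemma lp_norm_le_sum: "lp_norm p I f \<le> (\<Sum>i\<in>I. f i)"
proof (cases "p = \<infinity>")
  case True
  then show ?thesis
    using I f by (auto simp: lp_norm_def intro!: member_le_sum)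
next
  case False
  define q where "q = real_of_ereal p"
  define S where "S = (\<Sum>i\<in>I. f i)"
  have q: "1 \<le> q"
    unfolding q_def using p False by (rule real_exponent_ge_1)
  have S: "0 \<le> S" "\<And>i. i \<in> I \<Longrightarrow> f i \<le> S"
    unfolding S_def using I f by (auto intro: sum_nonneg member_le_sum)
  have "f i powr q \<le> f i * S powr (q - 1)" if "i \<in> I" for i
  proof -
    \<comment> \<open>For \<open>q = 1\<close> and \<open>f i = 0\<close> the second factor is
      \<open>0 powr 0\<close>, whose value here is 0. The identity and the monotonicity in the base
      hold in this case too.\<close>
    have "f i powr q = f i * f i powr (q - 1)"
      using f[OF that] by (simp add: powr_mult_base)
    also have "\<dots> \<le> f i * S powr (q - 1)"
      using q f[OF that] S that by (intro mult_left_mono powr_mono2) auto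
    finally show ?thesis .
  qed
  then have "(\<Sum>i\<in>I. f i powr q) \<le> S * S powr (q - 1)"
    unfolding S_def sum_distrib_right by (rule sum_mono)
  also have "\<dots> = S powr q"
    using S by (simp add: powr_mult_base)
  finally have "(\<Sum>i\<in>I. f i powr q) powr (1 / q) \<le> S"
    using q S by (intro powr_inverse_le) (auto intro: sum_nonneg)
  then show ?thesis
    using False by (simp add: lp_norm_def q_def S_def)
qed

text \<open>Each entry is at most the norm. The factor is cruder than the one from Hoelder's
  inequality, but it is the same for all exponents, infinity included.\<close>

lemma sum_le_card_lp_norm: "(\<Sum>i\<in>I. f i) \<le> card I * lp_norm p I f"
  using sum_bounded_above[of I f "lp_norm p I f"] member_le_lp_norm by simp

lemma lp_norm_eq_0_iff: "lp_norm p I f = 0 \<longleftrightarrow> (\<forall>i\<in>I. f i = 0)"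
proof
  assume "lp_norm p I f = 0"
  then show "\<forall>i\<in>I. f i = 0"
    using f member_le_lp_norm by (metis order_antisym)
next
  assume "\<forall>i\<in>I. f i = 0"
  then show "lp_norm p I f = 0"
    using lp_norm_le_sum lp_norm_nonneg by simp
qed

lemma lp_norm_mono:
  assumes "\<And>i. i \<in> I \<Longrightarrow> f i \<le> g i"
  shows "lp_norm p I f \<le> lp_norm p I g"
proof (cases "p = \<infinity>")
  case True
  then show ?thesis
    using I assms by (auto simp: lp_norm_def intro!: order_trans[OF assms Max_ge])
next
  case False
  then show ?thesis
    using real_exponent_ge_1[OF p False] f assms
    by (auto simp: lp_norm_def intro!: powr_mono2 sum_mono sum_nonneg)
qed

lemma lp_norm_powr:
  assumes "p \<noteq> \<infinity>"
  shows "lp_norm p I f powr real_of_ereal p = (\<Sum>i\<in>I. f i powr real_of_ereal p)"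
  using assms real_exponent_ge_1[OF p assms] by (simp add: lp_norm_def powr_powr sum_nonneg)

end

text \<open>For a real exponent, normalise by the norms \<open>S\<close> of \<open>f\<close> and
  \<open>T\<close> of \<open>g\<close>. Then \<open>(f + g) / (S + T)\<close> is a convex
  combination of \<open>f / S\<close> and \<open>g / T\<close>, both of norm 1, with weights
  \<open>S / (S + T)\<close> and \<open>T / (S + T)\<close>. Convexity of the power function bounds
  its power sum by 1.\<close>

lemma minkowski_inequality:
  assumes p: "1 \<le> p" and I: "finite I" "I \<noteq> {}"
    and f: "\<And>i. i \<in> I \<Longrightarrow> 0 \<le> f i" and g: "\<And>i. i \<in> I \<Longrightarrow> 0 \<le> g i"
  shows "lp_norm p I (\<lambda>i. f i + g i) \<le> lp_norm p I f + lp_norm p I g"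
proof (cases "p = \<infinity>")
  case True
  then show ?thesis
    using I by (auto simp: lp_norm_def intro!: add_mono)
next
  case False
  define q where "q = real_of_ereal p"
  define S where "S = lp_norm p I f"
  define T where "T = lp_norm p I g"
  have q: "1 \<le> q"
    unfolding q_def using p False by (rule real_exponent_ge_1)
  have nonneg: "0 \<le> S" "0 \<le> T"
    unfolding S_def T_def using assms by (auto intro: lp_norm_nonneg)
  \<comment> \<open>The normalisation divides by \<open>S\<close> and \<open>T\<close>. A function
    of norm 0 vanishes on \<open>I\<close>, which settles the other two cases.\<close>
  consider "S = 0" | "T = 0" | "0 < S" "0 < T"
    using nonneg by linarith
  then show ?thesis
  proof cases
    case 1
    then have "\<forall>i\<in>I. f i = 0"
      unfolding S_def using p I f by (simp add: lp_norm_eq_0_iff)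
    then have "lp_norm p I (\<lambda>i. f i + g i) = T"
      unfolding T_def lp_norm_def by simp
    then show ?thesis using 1 by (simp add: S_def T_def)
  next
    case 2
    then have "\<forall>i\<in>I. g i = 0"
      unfolding T_def using p I g by (simp add: lp_norm_eq_0_iff)
    then have "lp_norm p I (\<lambda>i. f i + g i) = S"
      unfolding S_def lp_norm_def by simp
    then show ?thesis using 2 by (simp add: S_def T_def)
  next
    case 3
    define u where "u = S / (S + T)"
    define v where "v = T / (S + T)"
    have uv: "0 \<le> u" "0 \<le> v" "u + v = 1"
      using 3 by (auto simp: u_def v_def simp flip: add_divide_distrib)
    have convex: "((f i + g i) / (S + T)) powr q
        \<le> u * (f i powr q / S powr q) + v * (g i powr q / T powr q)" if "i \<in> I" for i
    proof -
      have "(f i + g i) / (S + T) = u * (f i / S) + v * (g i / T)"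
        using 3 by (simp add: u_def v_def add_divide_distrib)
      also have "\<dots> powr q \<le> u * (f i / S) powr q + v * (g i / T) powr q"
        using q uv 3 f g that by (intro powr_convex_combination_le) auto
      finally show ?thesis
        using 3 f g that by (simp add: powr_divide)
    qed
    have ST: "(\<Sum>i\<in>I. f i powr q) = S powr q" "(\<Sum>i\<in>I. g i powr q) = T powr q"
      unfolding S_def T_def q_def using p I f g False by (auto simp: lp_norm_powr)
    have "(\<Sum>i\<in>I. (f i + g i) powr q) / (S + T) powr q = (\<Sum>i\<in>I. ((f i + g i) / (S + T)) powr q)"
      using f g nonneg by (simp add: powr_divide sum_divide_distrib)
    also have "\<dots> \<le> (\<Sum>i\<in>I. u * (f i powr q / S powr q) + v * (g i powr q / T powr q))"
      by (intro sum_mono convex)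
    also have "\<dots> = u * ((\<Sum>i\<in>I. f i powr q) / S powr q) + v * ((\<Sum>i\<in>I. g i powr q) / T powr q)"
      by (simp add: sum.distrib sum_distrib_left sum_divide_distrib)
    also have "\<dots> = 1"
      using 3 uv by (simp add: ST)
    finally have "(\<Sum>i\<in>I. (f i + g i) powr q) \<le> (S + T) powr q"
      using 3 by (simp add: divide_le_eq)
    then have "(\<Sum>i\<in>I. (f i + g i) powr q) powr (1 / q) \<le> S + T"
      using q nonneg by (intro powr_inverse_le) (auto intro: sum_nonneg)
    then show ?thesis
      using False by (simp add: lp_norm_def S_def T_def q_def)
  qed
qed

section \<open>Up-sums and down-sums as sums of positive parts over all coordinates\<close>

lemma up_sum_eq: "up_sum x y = (\<Sum>i\<in>UNIV. max 0 (x $ i - y $ i))"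
  unfolding up_sum_def by (rule sum.mono_neutral_cong_left) auto

text \<open>The two sides differ only in the ties, whose terms are 0.\<close>

lemma down_sum_eq: "down_sum x y = up_sum y x"
  unfolding up_sum_eq unfolding down_sum_def by (rule sum.mono_neutral_cong_left) auto

lemma up_sum_nonneg: "0 \<le> up_sum x y"
  by (simp add: up_sum_eq sum_nonneg)

text \<open>The positive part \<open>max 0 t\<close> is subadditive in \<open>t\<close>.\<close>

lemma up_sum_triangle: "up_sum x z \<le> up_sum x y + up_sum y z"
  unfolding up_sum_eq sum.distrib[symmetric] by (rule sum_mono) auto

lemma up_sum_add_swap: "up_sum x y + up_sum y x = (\<Sum>i\<in>UNIV. \<bar>x $ i - y $ i\<bar>)"
  unfolding up_sum_eq sum.distrib[symmetric] by (rule sum.cong) auto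

text \<open>The truth values serve as a two-element index set, so that \<open>lp_norm\<close>
  applies to the pair of sums.\<close>

definition up_down :: "real ^ 'n \<Rightarrow> real ^ 'n \<Rightarrow> bool \<Rightarrow> real" where
  "up_down x y b = (if b then up_sum x y else up_sum y x)"

lemma up_down_nonneg: "0 \<le> up_down x y b"
  by (simp add: up_down_def up_sum_nonneg)

lemma sum_up_down: "(\<Sum>b\<in>UNIV. up_down x y b) = (\<Sum>i\<in>UNIV. \<bar>x $ i - y $ i\<bar>)"
  by (simp add: up_down_def UNIV_bool add.commute flip: up_sum_add_swap)

lemma split_dist_eq: "split_dist p x y = lp_norm p UNIV (up_down x y)"
  by (simp add: split_dist_def lp_norm_def up_down_def UNIV_bool down_sum_eq max.commute add.commute)

lemma minkowski_dist_eq: "minkowski_dist p x y = lp_norm p UNIV (\<lambda>i. \<bar>x $ i - y $ i\<bar>)"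
  by (simp add: minkowski_dist_def lp_norm_def)

section \<open>Metric axioms and the equivalence\<close>

lemma Metric_space_lp_norm:
  fixes h :: "'b \<Rightarrow> 'b \<Rightarrow> 'a \<Rightarrow> real"
  assumes p: "1 \<le> p" and I: "finite I" "I \<noteq> {}"
    and nonneg: "\<And>x y i. i \<in> I \<Longrightarrow> 0 \<le> h x y i"
    and zero: "\<And>x y. (\<forall>i\<in>I. h x y i = 0) \<longleftrightarrow> x = y"
    and commute: "\<And>x y. lp_norm p I (h x y) = lp_norm p I (h y x)"
    and triangle: "\<And>x y z i. i \<in> I \<Longrightarrow> h x z i \<le> h x y i + h y z i"
  shows "Metric_space UNIV (\<lambda>x y. lp_norm p I (h x y))"
proof
  fix x y z
  show "0 \<le> lp_norm p I (h x y)"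
    using p I nonneg by (rule lp_norm_nonneg)
  show "lp_norm p I (h x y) = lp_norm p I (h y x)"
    by (rule commute)
  show "lp_norm p I (h x y) = 0 \<longleftrightarrow> x = y"
    using p I nonneg by (simp add: lp_norm_eq_0_iff zero)
  have "lp_norm p I (h x z) \<le> lp_norm p I (\<lambda>i. h x y i + h y z i)"
    using p I nonneg triangle by (intro lp_norm_mono) auto
  also have "\<dots> \<le> lp_norm p I (h x y) + lp_norm p I (h y z)"
    using p I nonneg by (intro minkowski_inequality) auto
  finally show "lp_norm p I (h x z) \<le> lp_norm p I (h x y) + lp_norm p I (h y z)" .
qed

lemma Metric_space_minkowski_dist:
  assumes "1 \<le> p"
  shows "Metric_space UNIV (minkowski_dist p)"
  unfolding minkowski_dist_eq[abs_def] using assms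
  by (intro Metric_space_lp_norm) (auto simp: vec_eq_iff abs_minus_commute)

lemma Metric_space_split_dist:
  fixes p :: ereal
  assumes "1 \<le> p"
  shows "Metric_space UNIV (split_dist p :: real ^ 'n \<Rightarrow> real ^ 'n \<Rightarrow> real)"
  unfolding split_dist_eq[abs_def]
proof (intro Metric_space_lp_norm)
  fix x y z :: "real ^ 'n" and b
  \<comment> \<open>Both entries are nonnegative, so they vanish together exactly when their sum
    does, and that sum is the \<open>\<ell>\<^sup>1\<close> distance.\<close>
  have "(\<forall>b\<in>UNIV. up_down x y b = 0) \<longleftrightarrow> (\<Sum>b\<in>UNIV. up_down x y b) = 0"
    by (simp add: sum_nonneg_eq_0_iff up_down_nonneg)
  also have "\<dots> \<longleftrightarrow> x = y"
    unfolding sum_up_down by (simp add: sum_nonneg_eq_0_iff vec_eq_iff)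
  finally show "(\<forall>b\<in>UNIV. up_down x y b = 0) \<longleftrightarrow> x = y" .
  \<comment> \<open>Swapping \<open>x\<close> and \<open>y\<close> exchanges the two entries.
    Symmetry thus holds for the norm but not entry by entry, hence the form of
    \<open>commute\<close> in \<open>Metric_space_lp_norm\<close>.\<close>
  show "lp_norm p UNIV (up_down x y) = lp_norm p UNIV (up_down y x)"
    by (simp add: lp_norm_def up_down_def UNIV_bool max.commute add.commute)
  show "up_down x z b \<le> up_down x y b + up_down y z b"
    \<comment> \<open>One instance for each entry. The \<open>False\<close> entry runs backwards,
      from \<open>z\<close> through \<open>y\<close> to \<open>x\<close>.\<close>
    using up_sum_triangle[of x z y] up_sum_triangle[of z x y] by (simp add: up_down_def)
qed (use assms up_down_nonneg in auto)

theorem proposition4p1: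
  fixes p :: ereal
  assumes "1 \<le> p"
  shows "Metric_space UNIV (split_dist p :: real ^ 'n \<Rightarrow> real ^ 'n \<Rightarrow> real) \<and>
    Metric_space UNIV (minkowski_dist p :: real ^ 'n \<Rightarrow> real ^ 'n \<Rightarrow> real) \<and>
    (\<exists>\<alpha> \<beta> :: real. 0 < \<alpha> \<and> 0 < \<beta> \<and>
      (\<forall>x y :: real ^ 'n.
         \<alpha> * split_dist p x y \<le> minkowski_dist p x y \<and>
         minkowski_dist p x y \<le> \<beta> * split_dist p x y))"
proof (intro conjI exI allI)
  show "Metric_space UNIV (split_dist p :: real ^ 'n \<Rightarrow> real ^ 'n \<Rightarrow> real)"
    using assms by (rule Metric_space_split_dist)
  show "Metric_space UNIV (minkowski_dist p :: real ^ 'n \<Rightarrow> real ^ 'n \<Rightarrow> real)"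
    using assms by (rule Metric_space_minkowski_dist)
  \<comment> \<open>Both constants come from \<open>sum_le_card_lp_norm\<close>: \<alpha> is the
    inverse of the number of coordinates, and \<beta> is the number of entries of
    \<open>up_down x y\<close>.\<close>
  show "0 < 1 / real CARD('n)" "0 < (2 :: real)"
    by simp_all
  fix x y :: "real ^ 'n"
  have "split_dist p x y \<le> (\<Sum>i\<in>UNIV. \<bar>x $ i - y $ i\<bar>)"
    unfolding split_dist_eq sum_up_down[symmetric]
    using assms up_down_nonneg by (intro lp_norm_le_sum) auto
  also have "\<dots> \<le> CARD('n) * minkowski_dist p x y"
    unfolding minkowski_dist_eq using assms by (intro sum_le_card_lp_norm) auto
  finally show "1 / real CARD('n) * split_dist p x y \<le> minkowski_dist p x y"
    by (simp add: divide_le_eq mult.commute)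
  have "minkowski_dist p x y \<le> (\<Sum>b\<in>UNIV. up_down x y b)"
    unfolding minkowski_dist_eq sum_up_down using assms by (intro lp_norm_le_sum) auto
  also have "\<dots> \<le> CARD(bool) * split_dist p x y"
    unfolding split_dist_eq using assms up_down_nonneg by (intro sum_le_card_lp_norm) auto
  finally show "minkowski_dist p x y \<le> 2 * split_dist p x y"
    by simp
qed

end
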